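(* Let $k$ be a positive integer and let $T$ be a string of length $n$. The total number of $k$-runs in $T$ (over all periods $\ell\in[1\mathinner{.\,.}\lfloor n/2\rfloor]$) is $\mathcal{O}(nk\log k)$.
   Context: Positions of a string $T$ are numbered $1,\dots,|T|$; $T[i\mathinner{.\,.} j]=T[i\mathinner{.\,.} j+1)$ denotes the substring $T[i]T[i+1]\cdots T[j]$, and $[i\mathinner{.\,.} j]=[i\mathinner{.\,.} j+1)=\{i,\dots,j\}$. For equal-length strings $X,Y$, the Hamming distance is $d_H(X,Y)=|\{i: X[i]\ne Y[i]\}|$. A $k$-mismatch square is a string $XY$ with $|X|=|Y|$ and $d_H(X,Y)\le k$. A $k$-run of period $\ell$ in $T$ is a substring $T[a\mathinner{.\,.} b)$ with $b-a\ge 2\ell$ such that $T[i\mathinner{.\,.} i+2\ell)$ is a $k$-mismatch square for every $i\in[a\mathinner{.\,.} b-2\ell]$, and which is maximal, i.e., it cannot be extended to the left or to the right while still satisfying this property for the same $\ell$. A $k$-run is identified by the triple $(a,b,\ell)$.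
   Formalization: The factor log k is read as max(1, log₂ k): for k = 1 the literal bound would be 0, which fails already for T = aa (it has a 1-run of period 1); for k ≥ 2 the bound is exactly O(nk log k) with one absolute constant. *)

theory Defs
  imports Complex_Main
begin

text \<open>Positions of a string are numbered from 1, whereas list indexing is 0-based;
  \<open>substr T i j\<close> is the half-open substring \<open>T[i..j)\<close>, for \<open>1 \<le> i \<le> j \<le> length T + 1\<close>.\<close>

definition substr :: "'a list \<Rightarrow> nat \<Rightarrow> nat \<Rightarrow> 'a list" where
  "substr T i j = take (j - i) (drop (i - 1) T)"

text \<open>Only meaningful for lists of equal length.\<close>

definition hamming_dist :: "'a list \<Rightarrow> 'a list \<Rightarrow> nat" where
  "hamming_dist X Y = card {i. i < length X \<and> X ! i \<noteq> Y ! i}"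

definition mismatch_square :: "nat \<Rightarrow> 'a list \<Rightarrow> bool" where
  "mismatch_square k S \<longleftrightarrow>
     (\<exists>X Y. S = X @ Y \<and> length X = length Y \<and> hamming_dist X Y \<le> k)"

definition k_repetition :: "nat \<Rightarrow> 'a list \<Rightarrow> nat \<Rightarrow> nat \<Rightarrow> nat \<Rightarrow> bool" where
  "k_repetition k T a b l \<longleftrightarrow>
     1 \<le> a \<and> b \<le> length T + 1 \<and> a + 2 * l \<le> b \<and>
     (\<forall>i\<in>{a..b - 2 * l}. mismatch_square k (substr T i (i + 2 * l)))"

definition is_k_run :: "nat \<Rightarrow> 'a list \<Rightarrow> nat \<Rightarrow> nat \<Rightarrow> nat \<Rightarrow> bool" where
  "is_k_run k T a b l \<longleftrightarrow>
     k_repetition k T a b l \<and>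
     (\<forall>a' b'. a' \<le> a \<and> b \<le> b' \<and> k_repetition k T a' b' l \<longrightarrow> a' = a \<and> b' = b)"

definition k_runs :: "nat \<Rightarrow> 'a list \<Rightarrow> (nat \<times> nat \<times> nat) set" where
  "k_runs k T = {(a, b, l). l \<in> {1..length T div 2} \<and> is_k_run k T a b l}"

lemma finite_k_runs: "finite (k_runs k T)"
proof (rule finite_subset)
  show "k_runs k T \<subseteq> {..length T + 1} \<times> {..length T + 1} \<times> {..length T}"
    by (auto simp: k_runs_def is_k_run_def k_repetition_def)
qed simp

end

theory Submission
  imports Defs "HOL-Library.Discrete_Functions"
begin

text \<open>Group the starts \<open>(p, l)\<close> of \<open>k\<close>-runs into blocks, where \<open>p\<close> ranges over an interval of length
  \<open>m = 2 ^ j\<close> and \<open>2 * m \<le> l < 4 * m\<close>.  A period has at most \<open>k + 1\<close> starts in a block.  Blocks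
  with \<open>O(k)\<close> periods contribute \<open>O(n * k)\<close> for each of the \<open>O(log k)\<close> scales with
  \<open>m = O(k)\<close>, and a geometrically decreasing amount for larger \<open>m\<close>.

  In a block with more periods, let \<open>d\<close> be the smallest difference of two of them; there are
  \<open>O(m / d)\<close> periods.  Nearby, \<open>T\<close> has \<open>O(k)\<close> mismatches with its shift by \<open>d\<close> over a length \<open>m\<close>,
  so a constant fraction of that fragment is covered by exact maximal \<open>d\<close>-periodic fragments of
  length \<open>\<Omega>(m / k)\<close>, each having an endpoint at distance \<open>O(m)\<close>.  The block is charged to them.
  A maximal fragment \<open>R\<close> of minimal period \<open>q\<close> is charged by \<open>O(1)\<close> blocks per scale, with
  \<open>O(k * min |R| m / q)\<close> each, and only for \<open>m = O(k * |R|)\<close>, which totals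
  \<open>O(k * log k * |R| / q)\<close>.  Finally \<open>\<Sum>|R| / q = O(n)\<close>, since maximal fragments with
  periods in the same dyadic range barely overlap.\<close>

section \<open>Mismatches and starts of runs\<close>

definition mismatches :: "'a list \<Rightarrow> nat \<Rightarrow> nat set \<Rightarrow> nat set" where
  "mismatches T l I = {i \<in> I. T ! i \<noteq> T ! (i + l)}"

abbreviation square_mismatches :: "'a list \<Rightarrow> nat \<Rightarrow> nat \<Rightarrow> nat set" where
  "square_mismatches T l p \<equiv> mismatches T l {p..<p + l}"

lemma finite_mismatches [simp]: "finite I \<Longrightarrow> finite (mismatches T l I)"
  by (simp add: mismatches_def)

lemma mismatches_mono: "I \<subseteq> J \<Longrightarrow> mismatches T l I \<subseteq> mismatches T l J"
  by (auto simp: mismatches_def)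

text \<open>\<open>T ! (i + l)\<close> and \<open>T ! (i + l + d)\<close> are both compared with \<open>T ! i\<close>.\<close>

lemma card_mismatches_difference_le:
  assumes "finite I"
  shows "card (mismatches T d ((\<lambda>i. i + l) ` I))
    \<le> card (mismatches T l I) + card (mismatches T (l + d) I)"
proof -
  let ?M = "mismatches T l I \<union> mismatches T (l + d) I"
  have "mismatches T d ((\<lambda>i. i + l) ` I) \<subseteq> (\<lambda>i. i + l) ` ?M"
    by (auto simp: mismatches_def ac_simps)
  then have "card (mismatches T d ((\<lambda>i. i + l) ` I)) \<le> card ((\<lambda>i. i + l) ` ?M)"
    using assms by (intro card_mono) auto
  also have "\<dots> \<le> card ?M"
    using assms by (intro card_image_le) auto
  also have "\<dots> \<le> card (mismatches T l I) + card (mismatches T (l + d) I)"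
    by (rule card_Un_le)
  finally show ?thesis .
qed

lemma card_square_mismatches_le_Suc:
  "card (square_mismatches T l p)
    \<le> card (square_mismatches T l (p + 1)) + (if T ! p = T ! (p + l) then 0 else 1)"
proof -
  let ?A = "if T ! p = T ! (p + l) then {} else {p}"
  have "square_mismatches T l p \<subseteq> square_mismatches T l (p + 1) \<union> ?A"
  proof
    fix i assume "i \<in> square_mismatches T l p"
    then show "i \<in> square_mismatches T l (p + 1) \<union> ?A"
      by (cases "i = p") (auto simp: mismatches_def)
  qed
  then have "card (square_mismatches T l p) \<le> card (square_mismatches T l (p + 1) \<union> ?A)"
    by (intro card_mono) auto
  also have "\<dots> \<le> card (square_mismatches T l (p + 1)) + card ?A"
    by (rule card_Un_le)
  finally show ?thesis by (auto split: if_splits)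
qed

lemma mismatch_square_append:
  assumes "length X = length Y"
  shows "mismatch_square k (X @ Y) \<longleftrightarrow> hamming_dist X Y \<le> k"
proof
  assume "mismatch_square k (X @ Y)"
  then obtain X' Y' where split: "X @ Y = X' @ Y'" "length X' = length Y'" "hamming_dist X' Y' \<le> k"
    unfolding mismatch_square_def by blast
  have "length X + length Y = length X' + length Y'"
    using arg_cong [OF split(1), of length] by simp
  with assms split(2) have "length X = length X'" by simp
  with split show "hamming_dist X Y \<le> k" by simp
next
  assume "hamming_dist X Y \<le> k"
  with assms show "mismatch_square k (X @ Y)"
    unfolding mismatch_square_def by metis
qed

lemma hamming_dist_eq_card_square_mismatches:
  assumes "p + 2 * l \<le> length T"
  shows "hamming_dist (take l (drop p T)) (take l (drop (p + l) T))
    = card (square_mismatches T l p)"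
proof -
  have "square_mismatches T l p = (\<lambda>i. i + p) ` {i. i < l \<and> T ! (p + i) \<noteq> T ! (p + l + i)}"
    (is "?A = ?f ` ?B")
  proof (intro equalityI subsetI)
    fix i assume "i \<in> ?A"
    then have "i - p \<in> ?B" "i = ?f (i - p)"
      by (auto simp: mismatches_def ac_simps)
    then show "i \<in> ?f ` ?B" by blast
  qed (auto simp: mismatches_def ac_simps)
  then have "card ?A = card ?B"
    by (simp add: card_image)
  also have "\<dots> = hamming_dist (take l (drop p T)) (take l (drop (p + l) T))"
    unfolding hamming_dist_def using assms by (intro arg_cong [of _ _ card]) auto
  finally show ?thesis by simp
qed

lemma mismatch_square_substr_iff:
  assumes "p + 2 * l \<le> length T"
  shows "mismatch_square k (substr T (p + 1) (p + 1 + 2 * l))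
    \<longleftrightarrow> card (square_mismatches T l p) \<le> k"
proof -
  have "substr T (p + 1) (p + 1 + 2 * l) = take l (drop p T) @ take l (drop (p + l) T)"
    using take_add [of l l "drop p T"] by (simp add: substr_def mult_2 add.commute)
  then show ?thesis
    using assms
    by (simp add: mismatch_square_append hamming_dist_eq_card_square_mismatches)
qed

lemma k_repetition_iff:
  "k_repetition k T (a + 1) b l \<longleftrightarrow>
     b \<le> length T + 1 \<and> a + 1 + 2 * l \<le> b \<and>
     (\<forall>p. a \<le> p \<longrightarrow> p + 2 * l < b \<longrightarrow> card (square_mismatches T l p) \<le> k)"
proof -
  have "(\<forall>i\<in>{a + 1..b - 2 * l}. mismatch_square k (substr T i (i + 2 * l))) \<longleftrightarrow>
      (\<forall>p. a \<le> p \<longrightarrow> p + 2 * l < b \<longrightarrow> card (square_mismatches T l p) \<le> k)" (is "?L \<longleftrightarrow> ?R")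
    if b_le: "b \<le> length T + 1"
  proof -
    have "{a + 1..b - 2 * l} = (\<lambda>p. p + 1) ` {p. a \<le> p \<and> p + 2 * l < b}" (is "_ = ?f ` ?P")
    proof (intro equalityI subsetI)
      fix i assume "i \<in> {a + 1..b - 2 * l}"
      then have "i - 1 \<in> ?P" "i = ?f (i - 1)" by auto
      then show "i \<in> ?f ` ?P" by blast
    qed auto
    then have "?L \<longleftrightarrow> (\<forall>p\<in>?P. mismatch_square k (substr T (p + 1) (p + 1 + 2 * l)))"
      by simp
    also have "\<dots> \<longleftrightarrow> (\<forall>p\<in>?P. card (square_mismatches T l p) \<le> k)"
      using b_le by (intro ball_cong refl mismatch_square_substr_iff) auto
    finally show ?thesis by blast
  qed
  then show ?thesis
    unfolding k_repetition_def by auto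
qed

text \<open>A pair \<open>(p, l)\<close> such that a \<open>k\<close>-run of period \<open>l\<close> begins immediately after the
  0-based position \<open>p\<close>.\<close>

definition run_starts :: "nat \<Rightarrow> 'a list \<Rightarrow> (nat \<times> nat) set" where
  "run_starts k T = {(p, l). 1 \<le> l \<and> p + 1 + 2 * l \<le> length T \<and>
     T ! p \<noteq> T ! (p + l) \<and> card (square_mismatches T l p) = k + 1}"

lemma finite_run_starts [simp]: "finite (run_starts k T)"
  by (rule finite_subset [of _ "{..length T} \<times> {..length T}"]) (auto simp: run_starts_def)

lemma is_k_run_imp_mismatches_before_gt:
  assumes run: "is_k_run k T (p + 2) b l"
  shows "k < card (square_mismatches T l p)"
proof (rule ccontr)
  assume "\<not> ?thesis"
  moreover have rep: "k_repetition k T (p + 1 + 1) b l"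
    using run by (simp add: is_k_run_def)
  ultimately have "card (square_mismatches T l r) \<le> k" if "p \<le> r" "r + 2 * l < b" for r
    using that unfolding k_repetition_iff by (cases "r = p") auto
  with rep have "k_repetition k T (p + 1) b l"
    unfolding k_repetition_iff by auto
  then have "p + 1 = p + 2"
    using run unfolding is_k_run_def by (meson add_left_mono le_refl one_le_numeral)
  then show False by simp
qed

lemma is_k_run_imp_run_start:
  assumes run: "is_k_run k T (p + 2) b l" and period_pos: "1 \<le> l"
  shows "(p, l) \<in> run_starts k T"
proof -
  have rep: "k_repetition k T (p + 1 + 1) b l"
    using run by (simp add: is_k_run_def)
  then have "card (square_mismatches T l (p + 1)) \<le> k" and fits: "p + 1 + 2 * l \<le> length T"
    unfolding k_repetition_iff by auto
  moreover have "k < card (square_mismatches T l p)"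
    using run by (rule is_k_run_imp_mismatches_before_gt)
  ultimately have "T ! p \<noteq> T ! (p + l)" "card (square_mismatches T l p) = k + 1"
    using card_square_mismatches_le_Suc [of T l p] by (auto split: if_splits)
  with fits period_pos show ?thesis by (simp add: run_starts_def)
qed

lemma is_k_run_end_unique:
  assumes "is_k_run k T a b l" "is_k_run k T a b' l"
  shows "b = b'"
  using assms unfolding is_k_run_def by (cases b b' rule: le_cases) blast+

lemma card_k_runs_le: "card (k_runs k T) \<le> length T + card (run_starts k T)"
proof -
  define start :: "nat \<times> nat \<times> nat \<Rightarrow> nat \<times> nat" where "start = (\<lambda>(a, b, l). (a, l))"
  let ?L = "(\<lambda>l. (1 :: nat, l)) ` {1..length T}" and ?S = "(\<lambda>(p, l). (p + 2, l)) ` run_starts k T"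
  have "start ` k_runs k T \<subseteq> ?L \<union> ?S"
  proof
    fix z assume "z \<in> start ` k_runs k T"
    then obtain a b l where z_eq: "z = (a, l)" and period: "1 \<le> l" "l \<le> length T"
      and run: "is_k_run k T a b l"
      by (auto simp: start_def k_runs_def)
    have "1 \<le> a"
      using run by (simp add: is_k_run_def k_repetition_def)
    then have "a = 1 \<or> a = (a - 2) + 2" by arith
    then consider (first) "a = 1" | (later) p where "a = p + 2" by blast
    then show "z \<in> ?L \<union> ?S"
    proof cases
      case first
      with z_eq period show ?thesis by auto
    next
      case later
      with run period have "(p, l) \<in> run_starts k T"
        by (auto intro: is_k_run_imp_run_start)
      with z_eq later show ?thesis by force
    qed
  qed
  moreover have "inj_on start (k_runs k T)"
    by (rule inj_onI) (auto simp: start_def k_runs_def intro: is_k_run_end_unique)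
  ultimately have "card (k_runs k T) \<le> card (?L \<union> ?S)"
    by (metis card_image card_mono finite_UnI finite_atLeastAtMost finite_imageI finite_run_starts)
  also have "\<dots> \<le> card ?L + card ?S"
    by (rule card_Un_le)
  also have "\<dots> \<le> length T + card (run_starts k T)"
    using card_image_le [of "{1..length T}" "\<lambda>l. (1 :: nat, l)"]
    by (intro add_mono card_image_le) simp_all
  finally show ?thesis .
qed

section \<open>Maximal periodic fragments\<close>

definition periodic_on :: "'a list \<Rightarrow> nat \<Rightarrow> nat \<Rightarrow> nat \<Rightarrow> bool" where
  "periodic_on T d s e \<longleftrightarrow>
     e \<le> length T \<and> (\<forall>i. s \<le> i \<and> i + d < e \<longrightarrow> T ! i = T ! (i + d))"

lemma periodic_onD: "periodic_on T d s e \<Longrightarrow> s \<le> i \<Longrightarrow> i + d < e \<Longrightarrow> T ! i = T ! (i + d)"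
  by (simp add: periodic_on_def)

lemma periodic_on_subset:
  "periodic_on T d s e \<Longrightarrow> s \<le> s' \<Longrightarrow> e' \<le> e \<Longrightarrow> periodic_on T d s' e'"
  by (auto simp: periodic_on_def)

lemma periodic_on_nth_add_mult:
  assumes "periodic_on T d s e" "s \<le> i" "i + d * r < e"
  shows "T ! (i + d * r) = T ! i"
  using assms(3)
proof (induction r)
  case (Suc r)
  have "T ! (i + d * r) = T ! (i + d * r + d)"
    using assms(2) Suc.prems by (intro periodic_onD [OF assms(1)]) (auto simp: ac_simps)
  with Suc show ?case by (simp add: ac_simps)
qed simp

text \<open>Inside a \<open>d\<close>-periodic fragment every mismatch repeats with period \<open>d\<close>.\<close>

lemma periodic_on_le_card_mismatches:
  assumes per: "periodic_on T d p (p + 2 * l)" and d_pos: "1 \<le> d" and neq: "T ! p \<noteq> T ! (p + l)"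
  shows "l \<le> d * card (square_mismatches T l p)"
proof (rule ccontr)
  let ?c = "card (square_mismatches T l p)"
  assume "\<not> ?thesis"
  then have "d * r < l" if "r \<le> ?c" for r
    using that by (meson le_less_trans mult_le_mono2 not_le)
  then have "T ! (p + d * r) = T ! p" "T ! (p + l + d * r) = T ! (p + l)" if "r \<le> ?c" for r
    using that by (intro periodic_on_nth_add_mult [OF per]; fastforce)+
  with neq \<open>\<And>r. r \<le> ?c \<Longrightarrow> d * r < l\<close>
  have "(\<lambda>r. p + d * r) ` {..?c} \<subseteq> square_mismatches T l p"
    by (auto simp: mismatches_def ac_simps)
  moreover have "inj_on (\<lambda>r. p + d * r) {..?c}"
    using d_pos by (auto simp: inj_on_def)
  ultimately have "card {..?c} \<le> ?c"
    by (intro card_inj_on_le) auto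
  then show False by simp
qed

lemma periodic_on_extend_right:
  assumes per: "periodic_on T q s e" and per': "periodic_on T q' s' e'" and "1 \<le> q'"
    and "s \<le> y" "s' \<le> y" "y + q + q' \<le> e" "e < e'"
  shows "periodic_on T q s (e + 1)"
proof -
  define i where "i = e - q - q'"
  have i_shift: "e = i + q + q'" "y \<le> i"
    using assms by (auto simp: i_def)
  have "T ! (i + q') = T ! i"
    using periodic_onD [OF per', of i] i_shift assms by simp
  also have "\<dots> = T ! (i + q)"
    using periodic_onD [OF per, of i] i_shift assms by simp
  also have "\<dots> = T ! e"
    using periodic_onD [OF per', of "i + q"] i_shift assms by simp
  finally have "T ! r = T ! (r + q)" if "s \<le> r" "r + q < e + 1" for r
    using periodic_onD [OF per, of r] that i_shift by (cases "r + q = e") (auto simp: ac_simps)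
  moreover have "e + 1 \<le> length T"
    using per' \<open>e < e'\<close> by (simp add: periodic_on_def)
  ultimately show ?thesis
    by (simp add: periodic_on_def)
qed

lemma periodic_on_extend_left:
  assumes per: "periodic_on T q s e" and per': "periodic_on T q' s' e'" and "1 \<le> q'"
    and "s \<le> y" "y + q + q' \<le> e" "y + q + q' \<le> e'" "s' < s"
  shows "periodic_on T q (s - 1) e"
proof -
  define i where "i = s - 1"
  have s_eq: "s = i + 1" using \<open>s' < s\<close> by (simp add: i_def)
  have "T ! i = T ! (i + q')"
    using periodic_onD [OF per', of i] s_eq assms by simp
  also have "\<dots> = T ! (i + q' + q)"
    using periodic_onD [OF per, of "i + q'"] s_eq assms by simp
  also have "\<dots> = T ! (i + q)"
    using periodic_onD [OF per', of "i + q"] s_eq assms by (simp add: ac_simps)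
  finally have "T ! r = T ! (r + q)" if "i \<le> r" "r + q < e" for r
    using periodic_onD [OF per, of r] that s_eq by (cases "r = i") auto
  moreover have "e \<le> length T"
    using per by (simp add: periodic_on_def)
  ultimately show ?thesis
    by (simp add: periodic_on_def i_def)
qed

definition maximal_periodic :: "'a list \<Rightarrow> nat \<Rightarrow> nat \<Rightarrow> nat \<Rightarrow> bool" where
  "maximal_periodic T d s e \<longleftrightarrow> periodic_on T d s e \<and>
     (\<forall>s' e'. s' \<le> s \<and> e \<le> e' \<and> periodic_on T d s' e' \<longrightarrow> s' = s \<and> e' = e)"

lemma maximal_periodic_imp_periodic_on: "maximal_periodic T d s e \<Longrightarrow> periodic_on T d s e"
  by (simp add: maximal_periodic_def)

lemma maximal_periodic_imp_le_length: "maximal_periodic T d s e \<Longrightarrow> e \<le> length T"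
  by (simp add: maximal_periodic_def periodic_on_def)

lemma maximal_periodic_end_ge:
  "maximal_periodic T d s e \<Longrightarrow> periodic_on T d s e' \<Longrightarrow> e' \<le> e"
  unfolding maximal_periodic_def by (metis le_refl linear)

lemma maximal_periodic_start_le:
  "maximal_periodic T d s e \<Longrightarrow> periodic_on T d s' e \<Longrightarrow> s \<le> s'"
  unfolding maximal_periodic_def by (metis le_refl linear)

lemma periodic_on_imp_maximal_periodic:
  assumes "periodic_on T d s e"
  obtains s' e' where "s' \<le> s" "e \<le> e'" "maximal_periodic T d s' e'"
proof -
  let ?P = "\<lambda>(a, b). a \<le> s \<and> e \<le> b \<and> periodic_on T d a b"
  let ?len = "\<lambda>(a, b). b + (s - a)"
  have "?P (s, e)" using assms by simp
  moreover have "\<forall>z. ?P z \<longrightarrow> ?len z < length T + s + 1"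
    by (auto simp: periodic_on_def)
  ultimately have "\<exists>z. ?P z \<and> (\<forall>y. ?P y \<longrightarrow> ?len y \<le> ?len z)"
    by (rule ex_has_greatest_nat)
  then obtain a b where extension: "a \<le> s" "e \<le> b" "periodic_on T d a b"
    and longest: "\<And>a' b'. a' \<le> s \<Longrightarrow> e \<le> b' \<Longrightarrow> periodic_on T d a' b' \<Longrightarrow> b' + (s - a') \<le> b + (s - a)"
    by fast
  have "a' = a \<and> b' = b" if "a' \<le> a" "b \<le> b'" "periodic_on T d a' b'" for a' b'
    using longest [of a' b'] that extension by linarith
  with extension(3) have "maximal_periodic T d a b"
    unfolding maximal_periodic_def by blast
  with extension that show thesis by blast
qed

lemma maximal_periodic_overlap_not_extend:
  assumes max: "maximal_periodic T q s e" and per: "periodic_on T q' s' e'" and q'_pos: "1 \<le> q'"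
    and overlap: "s \<le> y" "s' \<le> y" "y + q + q' \<le> e" "y + q + q' \<le> e'"
  shows "e' \<le> e \<and> s \<le> s'"
proof -
  note max_per = maximal_periodic_imp_periodic_on [OF max]
  have "\<not> e < e'"
    using periodic_on_extend_right [OF max_per per q'_pos overlap(1-3)]
      maximal_periodic_end_ge [OF max]
    by fastforce
  moreover have "\<not> s' < s"
    using periodic_on_extend_left [OF max_per per q'_pos overlap(1,3,4)]
      maximal_periodic_start_le [OF max]
    by fastforce
  ultimately show ?thesis by simp
qed

lemma maximal_periodic_overlap_unique:
  assumes "maximal_periodic T q s e" "maximal_periodic T q' s' e'" "1 \<le> q" "1 \<le> q'"
    and "s \<le> y" "s' \<le> y" "y + q + q' \<le> e" "y + q + q' \<le> e'"
  shows "s = s' \<and> e = e'"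
  using maximal_periodic_overlap_not_extend [of T q s e q' s' e' y]
    maximal_periodic_overlap_not_extend [of T q' s' e' q s e y]
    assms by (simp add: maximal_periodic_imp_periodic_on ac_simps)

section \<open>The exponents of long runs\<close>

text \<open>A fragment \<open>T[s..e)\<close>, with 0-based positions, is represented by the pair \<open>(s, e)\<close>.\<close>

abbreviation fragment_length :: "nat \<times> nat \<Rightarrow> nat" where
  "fragment_length R \<equiv> snd R - fst R"

abbreviation fragment_positions :: "nat \<times> nat \<Rightarrow> nat set" where
  "fragment_positions R \<equiv> {fst R..<snd R}"

abbreviation covered :: "(nat \<times> nat) set \<Rightarrow> nat set" where
  "covered \<D> \<equiv> \<Union>R\<in>\<D>. fragment_positions R"

text \<open>With six periods, at least half of the fragment is left after trimming three of them.\<close>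

definition long_period :: "'a list \<Rightarrow> nat \<times> nat \<Rightarrow> nat \<Rightarrow> bool" where
  "long_period T R d \<longleftrightarrow>
     1 \<le> d \<and> maximal_periodic T d (fst R) (snd R) \<and> fst R + 6 * d \<le> snd R"

definition long_runs :: "'a list \<Rightarrow> (nat \<times> nat) set" where
  "long_runs T = {R. \<exists>d. long_period T R d}"

definition min_period :: "'a list \<Rightarrow> nat \<times> nat \<Rightarrow> nat" where
  "min_period T R = (LEAST d. long_period T R d)"

lemma long_period_min_period: "R \<in> long_runs T \<Longrightarrow> long_period T R (min_period T R)"
  by (auto simp: long_runs_def min_period_def intro: LeastI)

lemma min_period_pos: "R \<in> long_runs T \<Longrightarrow> 1 \<le> min_period T R"
  using long_period_min_period [of R T] by (simp add: long_period_def)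

lemma maximal_periodic_min_period:
  "R \<in> long_runs T \<Longrightarrow> maximal_periodic T (min_period T R) (fst R) (snd R)"
  using long_period_min_period [of R T] by (simp add: long_period_def)

lemma min_period_le: "long_period T R d \<Longrightarrow> min_period T R \<le> d"
  by (simp add: min_period_def Least_le)

lemma finite_long_runs [simp]: "finite (long_runs T)"
  by (rule finite_subset [of _ "{..length T} \<times> {..length T}"])
     (auto simp: long_runs_def long_period_def maximal_periodic_def periodic_on_def)

lemma sum_half_powers_le:
  assumes "finite J"
  shows "(\<Sum>j\<in>J. (1 / 2) ^ j) \<le> (2 :: real)"
proof -
  have "(\<Sum>j\<in>J. (1 / 2) ^ j) \<le> (\<Sum>j. (1 / 2 :: real) ^ j)"
    using assms by (intro sum_le_suminf) (auto simp: summable_geometric)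
  also have "\<dots> = 2"
    by (simp add: suminf_geometric)
  finally show ?thesis .
qed

lemma floor_log_eq_imp_less_double:
  assumes "floor_log x = floor_log y" "1 \<le> y"
  shows "x < 2 * y"
  using floor_log_exp2_gt [of x] floor_log_exp2_le [of y] assms by simp

lemma sum_inverse_le_if_inj_on_floor_log:
  fixes q :: "'b \<Rightarrow> nat"
  assumes fin: "finite A" and pos: "\<And>x. x \<in> A \<Longrightarrow> 1 \<le> q x"
    and inj: "inj_on (\<lambda>x. floor_log (q x)) A"
  shows "(\<Sum>x\<in>A. 1 / real (q x)) \<le> 2"
proof -
  have "(\<Sum>x\<in>A. 1 / real (q x)) \<le> (\<Sum>x\<in>A. (1 / 2) ^ floor_log (q x))"
  proof (rule sum_mono)
    fix x assume "x \<in> A"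
    then have "2 ^ floor_log (q x) \<le> q x"
      using pos by (intro floor_log_exp2_le) fastforce
    then have "2 ^ floor_log (q x) \<le> real (q x)"
      by (metis of_nat_le_iff of_nat_numeral of_nat_power)
    then show "1 / real (q x) \<le> (1 / 2) ^ floor_log (q x)"
      by (simp add: power_one_over frac_le)
  qed
  also have "\<dots> = (\<Sum>j\<in>(\<lambda>x. floor_log (q x)) ` A. (1 / 2) ^ j)"
    using inj by (simp add: sum.reindex)
  also have "\<dots> \<le> 2"
    using fin by (intro sum_half_powers_le) simp
  finally show ?thesis .
qed

definition trimmed_positions :: "'a list \<Rightarrow> nat \<times> nat \<Rightarrow> nat set" where
  "trimmed_positions T R = {fst R..<snd R - 3 * min_period T R}"

text \<open>Two distinct long runs whose periods lie in the same dyadic range overlap in less than the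
  sum of their periods, so after trimming three periods off the right end they are disjoint.\<close>

lemma sum_inverse_min_periods_at_position_le:
  "(\<Sum>R | R \<in> long_runs T \<and> y \<in> trimmed_positions T R. 1 / real (min_period T R)) \<le> 2"
proof (rule sum_inverse_le_if_inj_on_floor_log)
  let ?A = "{R. R \<in> long_runs T \<and> y \<in> trimmed_positions T R}"
  show "finite ?A"
    by (rule finite_subset [of _ "long_runs T"]) auto
  show "1 \<le> min_period T R" if "R \<in> ?A" for R
    using that by (intro min_period_pos) simp
  show "inj_on (\<lambda>R. floor_log (min_period T R)) ?A"
  proof (rule inj_onI)
    fix R R' assume "R \<in> ?A" "R' \<in> ?A"
      and eq: "floor_log (min_period T R) = floor_log (min_period T R')"
    then have R_mem: "R \<in> long_runs T" "y \<in> trimmed_positions T R"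
      and R'_mem: "R' \<in> long_runs T" "y \<in> trimmed_positions T R'" by auto
    have "min_period T R < 2 * min_period T R'" "min_period T R' < 2 * min_period T R"
      using eq min_period_pos [OF R_mem(1)] min_period_pos [OF R'_mem(1)]
      by (simp_all add: floor_log_eq_imp_less_double)
    then have "fst R = fst R' \<and> snd R = snd R'"
      using R_mem R'_mem by (intro maximal_periodic_overlap_unique [where y = y])
        (auto simp: trimmed_positions_def intro: maximal_periodic_min_period min_period_pos)
    then show "R = R'" by (simp add: prod_eq_iff)
  qed
qed

lemma fragment_length_le_card_trimmed_positions:
  assumes "R \<in> long_runs T"
  shows "fragment_length R \<le> 2 * card (trimmed_positions T R)"
  using long_period_min_period [OF assms] by (auto simp: long_period_def trimmed_positions_def)

lemma sum_exponents_long_runs_le: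
  "(\<Sum>R\<in>long_runs T. real (fragment_length R) / real (min_period T R)) \<le> 4 * real (length T)"
proof -
  let ?q = "\<lambda>R. real (min_period T R)"
  have "real (fragment_length R) / ?q R
      \<le> 2 * (\<Sum>y | y \<in> {..<length T} \<and> y \<in> trimmed_positions T R. 1 / ?q R)"
    if R_long: "R \<in> long_runs T" for R
  proof -
    have "snd R \<le> length T"
      using maximal_periodic_imp_le_length [OF maximal_periodic_min_period [OF R_long]] .
    then have "{y. y \<in> {..<length T} \<and> y \<in> trimmed_positions T R} = trimmed_positions T R"
      by (auto simp: trimmed_positions_def)
    moreover have "real (fragment_length R) \<le> 2 * real (card (trimmed_positions T R))"
      using fragment_length_le_card_trimmed_positions [OF R_long]
      by (metis of_nat_le_iff of_nat_mult of_nat_numeral)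
    ultimately show ?thesis
      by (simp add: divide_right_mono)
  qed
  then have "(\<Sum>R\<in>long_runs T. real (fragment_length R) / ?q R)
      \<le> (\<Sum>R\<in>long_runs T. 2 * (\<Sum>y | y \<in> {..<length T} \<and> y \<in> trimmed_positions T R. 1 / ?q R))"
    by (rule sum_mono)
  also have "\<dots> = 2 * (\<Sum>y<length T. \<Sum>R | R \<in> long_runs T \<and> y \<in> trimmed_positions T R. 1 / ?q R)"
    unfolding sum_distrib_left [symmetric] by (subst sum.swap_restrict) auto
  also have "\<dots> \<le> 2 * (\<Sum>y<length T. 2)"
    by (intro mult_left_mono sum_mono sum_inverse_min_periods_at_position_le) auto
  finally show ?thesis by simp
qed

section \<open>Blocks of run starts\<close>

lemma card_le_mult_card_image:
  assumes fin: "finite A" and fibre: "\<And>y. y \<in> f ` A \<Longrightarrow> card {x \<in> A. f x = y} \<le> c"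
  shows "card A \<le> c * card (f ` A)"
proof -
  have "card A = (\<Sum>y\<in>f ` A. card {x \<in> A. f x = y})"
    using sum.image_gen [OF fin, of "\<lambda>_. 1 :: nat" f] by simp
  also have "\<dots> \<le> of_nat (card (f ` A)) * c"
    using fibre by (rule sum_bounded_above)
  finally show ?thesis by (simp add: mult.commute)
qed

lemma card_mult_gap_le:
  fixes A :: "nat set"
  assumes interval: "A \<subseteq> {a..<b}" and gap: "\<And>x y. x \<in> A \<Longrightarrow> y \<in> A \<Longrightarrow> x < y \<Longrightarrow> x + d \<le> y"
  shows "card A * d \<le> b + d - a"
proof -
  have "finite A"
    using interval finite_subset by blast
  moreover have "{x..<x + d} \<inter> {y..<y + d} = {}" if "x \<in> A" "y \<in> A" "x \<noteq> y" for x y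
    using gap [of x y] gap [of y x] that by (cases x y rule: linorder_cases) auto
  ultimately have "card A * d = card (\<Union>x\<in>A. {x..<x + d})"
    by (subst card_UN_disjoint) auto
  also have "\<dots> \<le> card {a..<b + d}"
    using interval by (intro card_mono) force+
  finally show ?thesis by simp
qed

lemma close_pair_in_interval:
  fixes A :: "nat set"
  assumes A_sub: "A \<subseteq> {a..<a + N}" and card_ge: "2 \<le> card A"
  obtains l d where "l \<in> A" "l + d \<in> A" "1 \<le> d" "card A * d \<le> 2 * N"
proof -
  let ?gap = "\<lambda>d. 1 \<le> d \<and> (\<exists>l\<in>A. l + d \<in> A)"
  have "\<not> is_singleton A" "A \<noteq> {}"
    using card_ge by (auto simp: is_singleton_altdef)
  then obtain x y where "x \<in> A" "y \<in> A" "x < y"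
    by (metis is_singletonI' linorder_neqE_nat)
  then have "?gap (y - x)" by (intro conjI bexI [of _ x]) auto
  define d where "d = (LEAST d. ?gap d)"
  have gap_d: "?gap d"
    unfolding d_def by (rule LeastI) fact
  then obtain l where close: "l \<in> A" "l + d \<in> A" by blast
  have "x + d \<le> y" if "x \<in> A" "y \<in> A" "x < y" for x y
  proof -
    have "?gap (y - x)"
      using that by (intro conjI bexI [of _ x]) auto
    then have "d \<le> y - x"
      unfolding d_def by (rule Least_le)
    with \<open>x < y\<close> show ?thesis by simp
  qed
  then have "card A * d \<le> a + N + d - a"
    using A_sub by (intro card_mult_gap_le) auto
  moreover have "d \<le> N"
    using subsetD [OF A_sub close(1)] subsetD [OF A_sub close(2)] by simp
  ultimately have "card A * d \<le> 2 * N" by simp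
  with close gap_d that show thesis by blast
qed

definition block :: "nat \<Rightarrow> 'a list \<Rightarrow> nat \<Rightarrow> nat \<Rightarrow> (nat \<times> nat) set" where
  "block k T m t = {(p, l) \<in> run_starts k T. p \<in> {m * t..<m * (t + 1)} \<and> l \<in> {2 * m..<4 * m}}"

lemma finite_block [simp]: "finite (block k T m t)"
  by (rule finite_subset [of _ "run_starts k T"]) (auto simp: block_def)

lemma block_periods_subset: "snd ` block k T m t \<subseteq> {2 * m..<2 * m + 2 * m}"
  by (auto simp: block_def)

lemma card_block_periods_le: "card (snd ` block k T m t) \<le> 2 * m"
  using card_mono [OF _ block_periods_subset [of k T m t]] by simp

text \<open>Every run start of period \<open>l\<close> in the block is a mismatch in the window of the leftmost one.\<close>

lemma card_block_fibre_le: "card {z \<in> block k T m t. snd z = l} \<le> k + 1"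
proof (cases "{z \<in> block k T m t. snd z = l} = {}")
  case False
  let ?F = "{z \<in> block k T m t. snd z = l}"
  define p where "p = Min (fst ` ?F)"
  have "p \<in> fst ` ?F"
    unfolding p_def using False by (intro Min_in) auto
  then have leftmost: "(p, l) \<in> block k T m t" by auto
  have "fst ` ?F \<subseteq> square_mismatches T l p"
  proof
    fix r assume r_mem: "r \<in> fst ` ?F"
    then have "p \<le> r"
      unfolding p_def by (intro Min_le) auto
    with r_mem leftmost show "r \<in> square_mismatches T l p"
      by (auto simp: block_def run_starts_def mismatches_def)
  qed
  then have "card (fst ` ?F) \<le> card (square_mismatches T l p)"
    by (intro card_mono) auto
  moreover have "card (fst ` ?F) = card ?F"
    by (intro card_image inj_onI) (auto simp: prod_eq_iff)
  ultimately show ?thesis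
    using leftmost by (simp add: block_def run_starts_def)
next
  case True
  then show ?thesis by (simp only: card.empty)
qed

lemma card_block_le: "card (block k T m t) \<le> (k + 1) * card (snd ` block k T m t)"
  by (intro card_le_mult_card_image card_block_fibre_le) simp

lemma close_run_starts_in_block:
  assumes "2 \<le> card (snd ` block k T m t)"
  obtains p l d where "(p, l) \<in> block k T m t" "1 \<le> d"
    "card (snd ` block k T m t) * d \<le> 4 * m"
    "m * (t + 2) + l + d \<le> length T"
    "card (mismatches T d {m * (t + 1) + l..<m * (t + 2) + l}) \<le> 2 * (k + 1)"
proof -
  obtain l d where "l \<in> snd ` block k T m t" "l + d \<in> snd ` block k T m t"
    and d_bounds: "1 \<le> d" "card (snd ` block k T m t) * d \<le> 2 * (2 * m)"
    using close_pair_in_interval [OF block_periods_subset assms] .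
  then obtain p p' where start: "(p, l) \<in> block k T m t" and start': "(p', l + d) \<in> block k T m t"
    by auto
  let ?I = "{m * (t + 1)..<m * (t + 2)}"
  have "?I \<subseteq> {p..<p + l}" "?I \<subseteq> {p'..<p' + (l + d)}"
    using start start' by (auto simp: block_def)
  then have "card (mismatches T l ?I) \<le> card (square_mismatches T l p)"
    "card (mismatches T (l + d) ?I) \<le> card (square_mismatches T (l + d) p')"
    by (simp_all add: card_mono mismatches_mono)
  then have "card (mismatches T l ?I) + card (mismatches T (l + d) ?I) \<le> 2 * (k + 1)"
    using start start' by (simp add: block_def run_starts_def)
  then have "card (mismatches T d ((\<lambda>i. i + l) ` ?I)) \<le> 2 * (k + 1)"
    using card_mismatches_difference_le [of ?I T d l] by simp
  moreover have "m * (t + 2) + l + d \<le> length T"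
    using start' by (auto simp: block_def run_starts_def)
  ultimately show thesis
    using that start d_bounds by simp
qed

section \<open>Long runs around a window with few mismatches\<close>

definition clean_part :: "nat set \<Rightarrow> nat \<Rightarrow> nat \<Rightarrow> nat \<Rightarrow> nat set" where
  "clean_part E h v w = \<Union>{{u..<u + h} |u. {u..<u + h} \<subseteq> {v..<w} \<and> {u..<u + h} \<inter> E = {}}"

lemma mem_cell_iff:
  fixes v h y :: nat
  assumes "1 \<le> h" "v \<le> y"
  shows "y \<in> {v + r * h..<v + r * h + h} \<longleftrightarrow> (y - v) div h = r"
proof -
  have "y \<in> {v + r * h..<v + r * h + h} \<longleftrightarrow> r * h \<le> y - v \<and> y - v < Suc r * h"
    using assms(2) by auto
  also have "\<dots> \<longleftrightarrow> r \<le> (y - v) div h \<and> (y - v) div h < Suc r"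
    using assms(1) by (simp add: less_eq_div_iff_mult_less_eq div_less_iff_less_mult del: mult_Suc)
  finally show ?thesis by auto
qed

lemma card_clean_part_ge:
  assumes fin: "finite E" and h_pos: "1 \<le> h"
  shows "(c - card E) * h \<le> card (clean_part E h v (v + c * h))"
proof -
  let ?C = "clean_part E h v (v + c * h)" and ?cell = "\<lambda>r. {v + r * h..<v + r * h + h}"
  define dirty where "dirty = (\<lambda>y. (y - v) div h) ` E"
  have dirty: "finite dirty" "card dirty \<le> card E"
    using fin by (auto simp: dirty_def card_image_le)
  have clean: "?cell r \<subseteq> ?C" if "r < c" "r \<notin> dirty" for r
  proof -
    have "Suc r * h \<le> c * h"
      using that by (intro mult_le_mono1) simp
    then have "?cell r \<subseteq> {v..<v + c * h}" by auto
    moreover have "(y - v) div h = r" if "y \<in> ?cell r" for y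
      using that h_pos mem_cell_iff [of h v y r] by auto
    with \<open>r \<notin> dirty\<close> have "?cell r \<inter> E = {}"
      by (force simp: dirty_def)
    ultimately show ?thesis
      unfolding clean_part_def by (intro Union_upper) blast
  qed
  have "{v..<v + c * h} \<subseteq> ?C \<union> (\<Union>r\<in>dirty. ?cell r)"
  proof
    fix y assume y_mem: "y \<in> {v..<v + c * h}"
    then have "y \<in> ?cell ((y - v) div h)" "(y - v) div h < c"
      using h_pos mem_cell_iff [of h v y] by (auto simp: less_mult_imp_div_less)
    with clean show "y \<in> ?C \<union> (\<Union>r\<in>dirty. ?cell r)" by blast
  qed
  moreover have "finite ?C"
    by (rule finite_subset [of _ "{v..<v + c * h}"]) (auto simp: clean_part_def)
  ultimately have "card {v..<v + c * h} \<le> card (?C \<union> (\<Union>r\<in>dirty. ?cell r))"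
    using dirty(1) by (intro card_mono) auto
  also have "\<dots> \<le> card ?C + card (\<Union>r\<in>dirty. ?cell r)"
    by (rule card_Un_le)
  also have "card (\<Union>r\<in>dirty. ?cell r) \<le> (\<Sum>r\<in>dirty. card (?cell r))"
    using dirty(1) by (rule card_UN_le)
  also have "\<dots> \<le> card E * h"
    using dirty(2) by simp
  finally show ?thesis
    by (simp add: diff_mult_distrib)
qed

lemma clean_part_subset_long_runs:
  assumes d_bounds: "1 \<le> d" "5 * d \<le> h" and w_le: "w + d \<le> length T"
  shows "clean_part (mismatches T d {v..<w}) h v w
    \<subseteq> {v..<w} \<inter> covered {R. long_period T R d \<and> h < fragment_length R}"
proof
  fix y assume "y \<in> clean_part (mismatches T d {v..<w}) h v w"
  then obtain u where window: "y \<in> {u..<u + h}" "{u..<u + h} \<subseteq> {v..<w}"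
    and clean: "{u..<u + h} \<inter> mismatches T d {v..<w} = {}"
    by (auto simp: clean_part_def)
  have "u + h + d \<le> length T"
    using d_bounds window(2) w_le by (cases "h = 0") auto
  moreover have "T ! i = T ! (i + d)" if "u \<le> i" "i < u + h" for i
  proof -
    have "i \<in> {u..<u + h}" using that by simp
    with clean window(2) show ?thesis by (auto simp: mismatches_def)
  qed
  ultimately have "periodic_on T d u (u + h + d)"
    by (simp add: periodic_on_def)
  then obtain s e where maximal: "s \<le> u" "u + h + d \<le> e" "maximal_periodic T d s e"
    by (rule periodic_on_imp_maximal_periodic)
  then have "long_period T (s, e) d"
    using d_bounds by (simp add: long_period_def)
  moreover have "h < fragment_length (s, e)" "y \<in> fragment_positions (s, e)"
    using maximal window(1) d_bounds by auto
  moreover have "y \<in> {v..<w}" using window by blast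
  ultimately show "y \<in> {v..<w} \<inter>
      covered {R. long_period T R d \<and> h < fragment_length R}"
    by blast
qed

text \<open>Of \<open>c\<close> cells of length \<open>m div c\<close>, at least half contain no mismatch.\<close>

lemma card_covered_by_long_runs_ge:
  assumes d_pos: "1 \<le> d" and few: "2 * card (mismatches T d {v..<v + m}) \<le> c"
    and c_bounds: "1 \<le> c" "8 * (c * d) \<le> m" and len: "v + m + d \<le> length T"
  shows "m \<le> 4 * card ({v..<v + m} \<inter>
    covered {R. long_period T R d \<and> m \<le> c * fragment_length R})"
    (is "_ \<le> 4 * card ?covered")
proof -
  define h where "h = m div c"
  let ?E = "mismatches T d {v..<v + c * h}"
  have "8 * d \<le> h"
    unfolding h_def using c_bounds by (simp add: less_eq_div_iff_mult_less_eq ac_simps)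
  then have h_ge: "1 \<le> h" "5 * d \<le> h" using d_pos by auto
  have cells: "c * h \<le> m" "m < c + c * h"
    using c_bounds by (simp_all add: h_def dividend_less_times_div)
  have "card ?E \<le> card (mismatches T d {v..<v + m})"
    using cells(1) by (intro card_mono mismatches_mono) auto
  with few have "c \<le> 2 * (c - card ?E)" by linarith
  then have "c * h \<le> 2 * ((c - card ?E) * h)"
    using mult_le_mono1 [of c "2 * (c - card ?E)" h] by simp
  also have "(c - card ?E) * h \<le> card (clean_part ?E h v (v + c * h))"
    using h_ge(1) by (intro card_clean_part_ge) simp
  also have "\<dots> \<le> card ?covered"
  proof (intro card_mono)
    have "m \<le> c * fragment_length R" if "h < fragment_length R" for R
      using cells(2) mult_le_mono2 [of "Suc h" "fragment_length R" c] that by simp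
    moreover have "clean_part ?E h v (v + c * h) \<subseteq> {v..<v + c * h} \<inter>
        covered {R. long_period T R d \<and> h < fragment_length R}"
      using d_pos h_ge(2) cells(1) len by (intro clean_part_subset_long_runs) auto
    moreover have "{v..<v + c * h} \<subseteq> {v..<v + m}"
      using cells(1) by simp
    ultimately show "clean_part ?E h v (v + c * h) \<subseteq> ?covered" by blast
  qed simp
  finally have "c * h \<le> 2 * card ?covered" by simp
  moreover have "c \<le> c * h"
    using h_ge(1) by simp
  ultimately show ?thesis
    using cells(2) by linarith
qed

section \<open>Charging blocks to long runs\<close>

definition run_weight :: "'a list \<Rightarrow> nat \<Rightarrow> nat \<times> nat \<Rightarrow> real" where
  "run_weight T m R = min (real (fragment_length R)) (real m) / real (min_period T R)"

lemma run_weight_nonneg [simp]: "0 \<le> run_weight T m R"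
  by (simp add: run_weight_def)

definition charged_runs :: "'a list \<Rightarrow> nat \<Rightarrow> nat \<Rightarrow> nat \<Rightarrow> (nat \<times> nat) set" where
  "charged_runs T k m t = {R \<in> long_runs T. m \<le> 4 * (k + 1) * fragment_length R \<and>
     (fst R \<in> {m * t..<m * (t + 9)} \<or> snd R \<in> {m * t..<m * (t + 9)})}"

lemma finite_charged_runs [simp]: "finite (charged_runs T k m t)"
  by (simp add: charged_runs_def)

lemma card_covered_le_sum_run_weight:
  assumes d_pos: "1 \<le> d" and fin: "finite W" "finite \<D>"
    and per: "\<And>R. R \<in> \<D> \<Longrightarrow> long_period T R d"
  shows "real (card (W \<inter> covered \<D>)) \<le> d * (\<Sum>R\<in>\<D>. run_weight T (card W) R)"
proof -
  have "real (card (W \<inter> fragment_positions R)) \<le> d * run_weight T (card W) R" if "R \<in> \<D>" for R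
  proof -
    let ?r = "min (real (fragment_length R)) (real (card W))" and ?q = "min_period T R"
    have q_bounds: "1 \<le> ?q" "?q \<le> d"
      using per [OF that] min_period_pos [of R T] by (auto simp: min_period_le long_runs_def)
    have "card (W \<inter> fragment_positions R) \<le> card (fragment_positions R)"
      "card (W \<inter> fragment_positions R) \<le> card W"
      using fin by (intro card_mono; simp)+
    then have "real (card (W \<inter> fragment_positions R)) \<le> ?r" by simp
    also have "\<dots> \<le> ?r * (real d / real ?q)"
      using q_bounds mult_left_mono [of 1 "real d / real ?q" ?r] by (simp add: le_divide_eq)
    finally show ?thesis by (simp add: run_weight_def mult.commute)
  qed
  then have "(\<Sum>R\<in>\<D>. real (card (W \<inter> fragment_positions R))) \<le> (\<Sum>R\<in>\<D>. d * run_weight T (card W) R)"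
    by (rule sum_mono)
  moreover have "card (W \<inter> covered \<D>) \<le> (\<Sum>R\<in>\<D>. card (W \<inter> fragment_positions R))"
    unfolding Int_UN_distrib using fin(2) by (rule card_UN_le)
  ultimately show ?thesis
    by (simp add: sum_distrib_left flip: of_nat_sum)
qed

text \<open>A fragment with the small period \<open>d\<close> cannot contain the whole square starting at \<open>p\<close>, because
  that square has too few mismatches; so one of its endpoints is near the block.\<close>

lemma long_period_mem_charged_runs:
  assumes start: "(p, l) \<in> block k T m t" and small: "(k + 1) * d < 2 * m"
    and per: "long_period T R d" and long: "m \<le> 4 * (k + 1) * fragment_length R"
    and y_mem: "y \<in> fragment_positions R" "y \<in> {m * (t + 1) + l..<m * (t + 2) + l}"
  shows "R \<in> charged_runs T k m t"
proof -
  have l_bounds: "2 * m \<le> l" "l < 4 * m" and p_bounds: "m * t \<le> p" "p < m * (t + 1)"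
    and mismatches: "T ! p \<noteq> T ! (p + l)" "card (square_mismatches T l p) = k + 1"
    using start by (auto simp: block_def run_starts_def)
  have "\<not> (fst R \<le> p \<and> p + 2 * l \<le> snd R)"
  proof
    assume "fst R \<le> p \<and> p + 2 * l \<le> snd R"
    then have "periodic_on T d p (p + 2 * l)"
      using per by (auto simp: long_period_def
          intro: periodic_on_subset [OF maximal_periodic_imp_periodic_on])
    then have "l \<le> d * (k + 1)"
      using periodic_on_le_card_mismatches [of T d p l] per mismatches by (simp add: long_period_def)
    with small l_bounds(1) show False by (simp add: mult.commute)
  qed
  then have "fst R \<in> {m * t..<m * (t + 9)} \<or> snd R \<in> {m * t..<m * (t + 9)}"
    using y_mem l_bounds p_bounds by (auto simp: distrib_left)
  with per long show ?thesis
    by (auto simp: charged_runs_def long_runs_def)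
qed

lemma dense_block_window:
  assumes dense: "128 * (k + 1) < card (snd ` block k T m t)"
  obtains d v where "1 \<le> d" "card (snd ` block k T m t) * d
    \<le> 16 * card ({v..<v + m} \<inter> covered {R \<in> charged_runs T k m t. long_period T R d})"
proof -
  let ?P = "card (snd ` block k T m t)" and ?c = "4 * (k + 1)"
  obtain p l d where start: "(p, l) \<in> block k T m t" and d_bounds: "1 \<le> d" "?P * d \<le> 4 * m"
    and len: "m * (t + 2) + l + d \<le> length T"
    and few: "card (mismatches T d {m * (t + 1) + l..<m * (t + 2) + l}) \<le> 2 * (k + 1)"
    using close_run_starts_in_block [of k T m t] dense by auto
  have "128 * (k + 1) * d \<le> ?P * d"
    using dense by (intro mult_le_mono1) simp
  with d_bounds have small: "8 * (?c * d) \<le> m" by (simp add: algebra_simps)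
  define v where "v = m * (t + 1) + l"
  have window: "m * (t + 2) + l = v + m"
    by (simp add: v_def algebra_simps)
  let ?long = "{R. long_period T R d \<and> m \<le> ?c * fragment_length R}"
  let ?charged = "{R \<in> charged_runs T k m t. long_period T R d}"
  have "m \<le> 4 * card ({v..<v + m} \<inter> covered ?long)"
    using d_bounds(1) few small len unfolding window v_def [symmetric]
    by (intro card_covered_by_long_runs_ge) auto
  moreover have "R \<in> charged_runs T k m t"
    if "R \<in> ?long" "y \<in> fragment_positions R" "y \<in> {v..<v + m}" for R y
    using that small d_bounds by (intro long_period_mem_charged_runs [OF start, of d R y])
      (auto simp: v_def algebra_simps)
  then have "{v..<v + m} \<inter> covered ?long \<subseteq> {v..<v + m} \<inter> covered ?charged" by blast
  then have "card ({v..<v + m} \<inter> covered ?long) \<le> card ({v..<v + m} \<inter> covered ?charged)"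
    by (intro card_mono) auto
  ultimately have "?P * d \<le> 16 * card ({v..<v + m} \<inter> covered ?charged)"
    using d_bounds(2) by linarith
  with d_bounds(1) show thesis by (rule that)
qed

lemma card_dense_block_periods_le:
  assumes dense: "128 * (k + 1) < card (snd ` block k T m t)"
  shows "real (card (snd ` block k T m t)) \<le> 16 * (\<Sum>R\<in>charged_runs T k m t. run_weight T m R)"
proof -
  let ?P = "real (card (snd ` block k T m t))"
  obtain d v where d_pos: "1 \<le> d" and window: "card (snd ` block k T m t) * d
      \<le> 16 * card ({v..<v + m} \<inter> covered {R \<in> charged_runs T k m t. long_period T R d})"
    using dense_block_window [OF dense] .
  let ?charged = "{R \<in> charged_runs T k m t. long_period T R d}"
  have "real (card ({v..<v + m} \<inter> covered ?charged))
      \<le> d * (\<Sum>R\<in>?charged. run_weight T (card {v..<v + m}) R)"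
    by (intro card_covered_le_sum_run_weight d_pos) auto
  moreover have "real (card (snd ` block k T m t) * d)
      \<le> real (16 * card ({v..<v + m} \<inter> covered ?charged))"
    using window by (simp only: of_nat_le_iff)
  ultimately have "real d * ?P \<le> real d * (16 * (\<Sum>R\<in>?charged. run_weight T m R))"
    by (simp add: mult.commute [of ?P] mult.left_commute [of "real d"])
  then have "?P \<le> 16 * (\<Sum>R\<in>?charged. run_weight T m R)"
    using d_pos by simp
  also have "\<dots> \<le> 16 * (\<Sum>R\<in>charged_runs T k m t. run_weight T m R)"
    by (intro mult_left_mono sum_mono2) auto
  finally show ?thesis .
qed

lemma card_block_le_sum_run_weight:
  "real (card (block k T m t)) \<le> real (k + 1) *
    (2 * min (real m) (64 * real (k + 1)) + 16 * (\<Sum>R\<in>charged_runs T k m t. run_weight T m R))"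
  (is "_ \<le> _ * (?sparse + ?dense)")
proof -
  have "real (card (snd ` block k T m t)) \<le> ?sparse + ?dense"
  proof (cases "128 * (k + 1) < card (snd ` block k T m t)")
    case True
    have "0 \<le> ?sparse" by simp
    with card_dense_block_periods_le [OF True] show ?thesis by linarith
  next
    case False
    then have "real (card (snd ` block k T m t)) \<le> real (128 * (k + 1))"
      "real (card (snd ` block k T m t)) \<le> real (2 * m)"
      using card_block_periods_le [of k T m t] by (simp_all only: of_nat_le_iff not_less)
    then have "real (card (snd ` block k T m t)) \<le> ?sparse" by (simp add: min_def)
    moreover have "0 \<le> ?dense"
      by (intro mult_nonneg_nonneg sum_nonneg) auto
    ultimately show ?thesis by linarith
  qed
  then have "real (k + 1) * real (card (snd ` block k T m t)) \<le> real (k + 1) * (?sparse + ?dense)"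
    by (intro mult_left_mono) auto
  moreover have "real (card (block k T m t)) \<le> real (k + 1) * real (card (snd ` block k T m t))"
    using card_block_le [of k T m t] by (simp only: of_nat_le_iff flip: of_nat_mult)
  ultimately show ?thesis by linarith
qed

section \<open>Summation over positions and scales\<close>

lemma card_translates_containing_le:
  fixes m :: nat
  assumes "1 \<le> m"
  shows "finite {t. s \<in> {m * t..<m * (t + c)}}" "card {t. s \<in> {m * t..<m * (t + c)}} \<le> c"
proof -
  have "t \<le> s div m \<and> s div m < t + c" if "s \<in> {m * t..<m * (t + c)}" for t
    using that assms
    by (auto simp: less_eq_div_iff_mult_less_eq div_less_iff_less_mult mult.commute)
  then have sub: "{t. s \<in> {m * t..<m * (t + c)}} \<subseteq> {Suc (s div m) - c..<Suc (s div m)}"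
    by force
  then show "finite {t. s \<in> {m * t..<m * (t + c)}}"
    by (rule finite_subset) simp
  show "card {t. s \<in> {m * t..<m * (t + c)}} \<le> c"
    using card_mono [OF _ sub] by simp
qed

lemma card_charging_blocks_le:
  assumes m_pos: "1 \<le> m"
  shows "card {t \<in> A. R \<in> charged_runs T k m t} \<le> 18"
proof -
  let ?near = "\<lambda>s. {t. s \<in> {m * t..<m * (t + 9)}}"
  have "card {t \<in> A. R \<in> charged_runs T k m t} \<le> card (?near (fst R) \<union> ?near (snd R))"
    by (intro card_mono finite_UnI card_translates_containing_le [OF m_pos])
       (auto simp: charged_runs_def)
  also have "\<dots> \<le> card (?near (fst R)) + card (?near (snd R))"
    by (rule card_Un_le)
  also have "\<dots> \<le> 9 + 9"
    by (intro add_mono card_translates_containing_le [OF m_pos])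
  finally show ?thesis by simp
qed

lemma sum_charged_runs_at_scale_le:
  assumes fin: "finite A" and m_pos: "1 \<le> m"
  shows "(\<Sum>t\<in>A. \<Sum>R\<in>charged_runs T k m t. run_weight T m R)
    \<le> 18 * (\<Sum>R | R \<in> long_runs T \<and> m \<le> 4 * (k + 1) * fragment_length R. run_weight T m R)"
proof -
  let ?L = "{R. R \<in> long_runs T \<and> m \<le> 4 * (k + 1) * fragment_length R}"
  have "{R \<in> ?L. R \<in> charged_runs T k m t} = charged_runs T k m t" for t
    by (auto simp: charged_runs_def)
  then have "(\<Sum>t\<in>A. \<Sum>R\<in>charged_runs T k m t. run_weight T m R)
      = (\<Sum>t\<in>A. \<Sum>R | R \<in> ?L \<and> R \<in> charged_runs T k m t. run_weight T m R)"
    by simp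
  also have "\<dots> = (\<Sum>R\<in>?L. \<Sum>t | t \<in> A \<and> R \<in> charged_runs T k m t. run_weight T m R)"
    using fin by (intro sum.swap_restrict) auto
  also have "\<dots> = (\<Sum>R\<in>?L. real (card {t \<in> A. R \<in> charged_runs T k m t}) * run_weight T m R)"
    by simp
  also have "\<dots> \<le> (\<Sum>R\<in>?L. 18 * run_weight T m R)"
    using card_charging_blocks_le [OF m_pos] by (intro sum_mono mult_right_mono) auto
  finally show ?thesis
    by (simp only: sum_distrib_left)
qed

lemma sum_min_one_div_power_le:
  fixes c :: real
  assumes fin: "finite J" and c_bounds: "0 \<le> c" "c \<le> 2 ^ a"
  shows "(\<Sum>j\<in>J. min 1 (c / 2 ^ j)) \<le> real a + 2"
proof -
  have "(\<Sum>j\<in>J. min 1 (c / 2 ^ j))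
      = (\<Sum>j\<in>J \<inter> {..<a}. min 1 (c / 2 ^ j)) + (\<Sum>j\<in>J - {..<a}. min 1 (c / 2 ^ j))"
    using fin by (subst sum.Int_Diff) auto
  also have "(\<Sum>j\<in>J \<inter> {..<a}. min 1 (c / 2 ^ j)) \<le> real (card (J \<inter> {..<a})) * 1"
    by (intro sum_bounded_above) auto
  also have "\<dots> \<le> real a"
    using card_mono [of "{..<a}" "J \<inter> {..<a}"] by simp
  also have "(\<Sum>j\<in>J - {..<a}. min 1 (c / 2 ^ j)) \<le> (\<Sum>j\<in>J - {..<a}. (1 / 2) ^ (j - a))"
  proof (rule sum_mono)
    fix j assume "j \<in> J - {..<a}"
    then have j_eq: "j = (j - a) + a" by simp
    have "c / 2 ^ j \<le> 2 ^ a / 2 ^ j"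
      using c_bounds by (intro divide_right_mono) auto
    also have "\<dots> = (1 / 2) ^ (j - a)"
      by (subst j_eq) (simp add: power_add power_one_over)
    finally show "min 1 (c / 2 ^ j) \<le> (1 / 2) ^ (j - a)" by simp
  qed
  also have "\<dots> = (\<Sum>i\<in>(\<lambda>j. j - a) ` (J - {..<a}). (1 / 2) ^ i)"
    by (subst sum.reindex) (auto simp: inj_on_def)
  also have "\<dots> \<le> 2"
    using fin by (intro sum_half_powers_le) simp
  finally show ?thesis by simp
qed

text \<open>Reversing the order of the scales reduces this to the previous lemma.\<close>

lemma sum_min_power_le:
  fixes r :: real
  assumes r_pos: "0 < r" and scales: "finite J" "\<And>j. j \<in> J \<Longrightarrow> 2 ^ j \<le> 2 ^ a * r"
  shows "(\<Sum>j\<in>J. min r (2 ^ j)) \<le> r * (real a + 2)"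
proof (cases "J = {}")
  case False
  define N where "N = Max J"
  have N_max: "N \<in> J" "\<And>j. j \<in> J \<Longrightarrow> j \<le> N"
    using scales False by (auto simp: N_def)
  have "min r (2 ^ j) = r * min 1 ((2 ^ N / r) / 2 ^ (N - j))" if "j \<in> J" for j
  proof -
    have "(2::real) ^ N = 2 ^ j * 2 ^ (N - j)"
      using N_max(2) [OF that] by (simp flip: power_add)
    with r_pos show ?thesis by (simp add: min_def field_simps)
  qed
  then have "(\<Sum>j\<in>J. min r (2 ^ j)) = r * (\<Sum>j\<in>J. min 1 ((2 ^ N / r) / 2 ^ (N - j)))"
    by (simp add: sum_distrib_left)
  also have "(\<Sum>j\<in>J. min 1 ((2 ^ N / r) / 2 ^ (N - j)))
      = (\<Sum>i\<in>(\<lambda>j. N - j) ` J. min 1 ((2 ^ N / r) / 2 ^ i))"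
  proof (subst sum.reindex)
    show "inj_on (\<lambda>j. N - j) J"
      using N_max(2) by (metis diff_diff_cancel inj_onI)
  qed simp
  also have "\<dots> \<le> real a + 2"
    using scales(1) scales(2) [OF N_max(1)] r_pos by (intro sum_min_one_div_power_le) (auto simp: field_simps)
  finally show ?thesis
    using r_pos by simp
qed (use r_pos in simp)

lemma sum_run_weight_le:
  assumes R_long: "R \<in> long_runs T" and k_le: "4 * (k + 1) \<le> 2 ^ a" and fin: "finite J"
  shows "(\<Sum>j | j \<in> J \<and> 2 ^ j \<le> 4 * (k + 1) * fragment_length R. run_weight T (2 ^ j) R)
    \<le> (real a + 2) * (real (fragment_length R) / real (min_period T R))"
proof -
  let ?r = "real (fragment_length R)"
  let ?J = "{j. j \<in> J \<and> 2 ^ j \<le> 4 * (k + 1) * fragment_length R}"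
  have "0 < ?r"
    using long_period_min_period [OF R_long] by (simp add: long_period_def)
  moreover have "2 ^ j \<le> 2 ^ a * ?r" if "j \<in> ?J" for j
  proof -
    have "2 ^ j \<le> 2 ^ a * fragment_length R"
      using that mult_le_mono1 [OF k_le, of "fragment_length R"] by (blast intro: order.trans)
    then have "real (2 ^ j) \<le> real (2 ^ a * fragment_length R)"
      by (simp only: of_nat_le_iff)
    then show ?thesis by simp
  qed
  ultimately have "(\<Sum>j\<in>?J. min ?r (2 ^ j)) \<le> ?r * (real a + 2)"
    using fin by (intro sum_min_power_le) auto
  then have "(\<Sum>j\<in>?J. min ?r (2 ^ j)) / real (min_period T R)
      \<le> ?r * (real a + 2) / real (min_period T R)"
    by (rule divide_right_mono) simp
  then show ?thesis
    by (simp add: run_weight_def sum_divide_distrib mult.commute)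
qed

lemma sum_charged_runs_le:
  assumes k_le: "4 * (k + 1) \<le> 2 ^ a" and fin: "finite J" "\<And>j. finite (A j)"
  shows "(\<Sum>j\<in>J. \<Sum>t\<in>A j. \<Sum>R\<in>charged_runs T k (2 ^ j) t. run_weight T (2 ^ j) R)
    \<le> 72 * (real (length T) * (real a + 2))"
proof -
  let ?long = "\<lambda>j R. 2 ^ j \<le> 4 * (k + 1) * fragment_length R"
  have "(\<Sum>j\<in>J. \<Sum>t\<in>A j. \<Sum>R\<in>charged_runs T k (2 ^ j) t. run_weight T (2 ^ j) R)
      \<le> (\<Sum>j\<in>J. 18 * (\<Sum>R | R \<in> long_runs T \<and> ?long j R. run_weight T (2 ^ j) R))"
    using fin(2) by (intro sum_mono sum_charged_runs_at_scale_le) auto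
  also have "\<dots> = 18 * (\<Sum>j\<in>J. \<Sum>R | R \<in> long_runs T \<and> ?long j R. run_weight T (2 ^ j) R)"
    by (simp only: sum_distrib_left)
  also have "(\<Sum>j\<in>J. \<Sum>R | R \<in> long_runs T \<and> ?long j R. run_weight T (2 ^ j) R)
      = (\<Sum>R\<in>long_runs T. \<Sum>j | j \<in> J \<and> ?long j R. run_weight T (2 ^ j) R)"
    using fin(1) by (intro sum.swap_restrict) auto
  also have "\<dots> \<le> (\<Sum>R\<in>long_runs T.
      (real a + 2) * (real (fragment_length R) / real (min_period T R)))"
    using k_le fin(1) by (intro sum_mono sum_run_weight_le)
  also have "\<dots> \<le> (real a + 2) * (4 * real (length T))"
    unfolding sum_distrib_left [symmetric]
    by (intro mult_left_mono sum_exponents_long_runs_le) simp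
  finally show ?thesis by (simp add: mult_ac)
qed

lemma finite_power_le: "finite {j. 2 ^ j \<le> (n :: nat)}"
proof (rule finite_subset)
  show "{j. 2 ^ j \<le> n} \<subseteq> {..n}"
    using less_exp [THEN less_imp_le, THEN order.trans] by auto
qed simp

text \<open>There are at most \<open>2 * n / 2 ^ j\<close> blocks at scale \<open>2 ^ j\<close>.\<close>

lemma sum_min_scale_over_blocks_le:
  fixes c :: real
  assumes c_bounds: "0 \<le> c" "c \<le> 2 ^ a"
  shows "(\<Sum>j | 2 ^ j \<le> n. \<Sum>t\<le>n div 2 ^ j. min (real (2 ^ j)) c) \<le> 2 * (real n * (real a + 2))"
proof -
  have "(\<Sum>t\<le>n div 2 ^ j. min (real (2 ^ j)) c) \<le> 2 * real n * min 1 (c / 2 ^ j)"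
    if "2 ^ j \<le> n" for j
  proof -
    have "(n div 2 ^ j + 1) * 2 ^ j \<le> 2 * n"
      using that by (simp add: add_mult_distrib mult_2 add_mono)
    then have blocks: "real ((n div 2 ^ j + 1) * 2 ^ j) \<le> real (2 * n)"
      by (simp only: of_nat_le_iff)
    have "min (real (2 ^ j)) c = 2 ^ j * min 1 (c / 2 ^ j)"
      by (simp add: min_def field_simps)
    then have "(\<Sum>t\<le>n div 2 ^ j. min (real (2 ^ j)) c)
        = real ((n div 2 ^ j + 1) * 2 ^ j) * min 1 (c / 2 ^ j)"
      by (simp add: algebra_simps)
    also have "\<dots> \<le> real (2 * n) * min 1 (c / 2 ^ j)"
      using blocks c_bounds(1) by (intro mult_right_mono) auto
    finally show ?thesis by simp
  qed
  then have "(\<Sum>j | 2 ^ j \<le> n. \<Sum>t\<le>n div 2 ^ j. min (real (2 ^ j)) c)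
      \<le> (\<Sum>j | 2 ^ j \<le> n. 2 * real n * min 1 (c / 2 ^ j))"
    by (intro sum_mono) simp
  also have "\<dots> = 2 * real n * (\<Sum>j | 2 ^ j \<le> n. min 1 (c / 2 ^ j))"
    by (simp only: sum_distrib_left)
  also have "\<dots> \<le> 2 * real n * (real a + 2)"
    using c_bounds finite_power_le by (intro mult_left_mono sum_min_one_div_power_le) auto
  finally show ?thesis by (simp add: mult_ac)
qed

lemma run_start_mem_block:
  assumes start: "(p, l) \<in> run_starts k T" and l_neq_1: "l \<noteq> 1"
  obtains j where "2 ^ j \<le> length T" "p div 2 ^ j \<le> length T div 2 ^ j"
    "(p, l) \<in> block k T (2 ^ j) (p div 2 ^ j)"
proof -
  define j where "j = floor_log (l div 2)"
  have fits: "1 \<le> l" "p + 1 + 2 * l \<le> length T"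
    using start by (auto simp: run_starts_def)
  with l_neq_1 have "floor_log l = Suc j"
    by (simp add: j_def floor_log_rec del: floor_log_half)
  then have l_bounds: "2 * 2 ^ j \<le> l" "l < 4 * 2 ^ j"
    using floor_log_exp2_le [of l] floor_log_exp2_gt [of l] fits by auto
  have "2 ^ j * (p div 2 ^ j) \<le> p" "p < 2 ^ j * (p div 2 ^ j + 1)"
    using dividend_less_times_div [of "2 ^ j" p] by simp_all
  with start l_bounds have "(p, l) \<in> block k T (2 ^ j) (p div 2 ^ j)"
    by (simp add: block_def)
  with fits l_bounds show thesis
    by (intro that) (auto intro: div_le_mono)
qed

lemma card_run_starts_le_sum_card_block:
  "card (run_starts k T) \<le> length T +
     (\<Sum>j | 2 ^ j \<le> length T. \<Sum>t\<le>length T div 2 ^ j. card (block k T (2 ^ j) t))"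
proof -
  let ?n = "length T"
  let ?one = "(\<lambda>p. (p, 1 :: nat)) ` {..<?n}"
  let ?J = "{j. 2 ^ j \<le> ?n}"
  let ?blocks = "\<Union>j\<in>?J. \<Union>t\<in>{..?n div 2 ^ j}. block k T (2 ^ j) t"
  have "run_starts k T \<subseteq> ?one \<union> ?blocks"
  proof
    fix z assume z_start: "z \<in> run_starts k T"
    obtain p l where z_eq: "z = (p, l)" by (cases z)
    show "z \<in> ?one \<union> ?blocks"
    proof (cases "l = 1")
      case True
      with z_start z_eq show ?thesis by (auto simp: run_starts_def)
    next
      case False
      with z_start z_eq obtain j where "2 ^ j \<le> ?n" "p div 2 ^ j \<le> ?n div 2 ^ j"
        "z \<in> block k T (2 ^ j) (p div 2 ^ j)"
        using run_start_mem_block [of p l k T] by metis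
      then have "z \<in> ?blocks"
        by (intro UN_I [of j] UN_I [of "p div 2 ^ j"]) simp_all
      then show ?thesis by (rule UnI2)
    qed
  qed
  then have "card (run_starts k T) \<le> card (?one \<union> ?blocks)"
    using finite_power_le by (intro card_mono) auto
  also have "\<dots> \<le> card ?one + card ?blocks"
    by (rule card_Un_le)
  also have "card ?one \<le> ?n"
    using card_image_le [of "{..<?n}" "\<lambda>p. (p, 1 :: nat)"] by simp
  also have "card ?blocks \<le> (\<Sum>j\<in>?J. card (\<Union>t\<in>{..?n div 2 ^ j}. block k T (2 ^ j) t))"
    using finite_power_le by (rule card_UN_le)
  also have "\<dots> \<le> (\<Sum>j\<in>?J. \<Sum>t\<le>?n div 2 ^ j. card (block k T (2 ^ j) t))"
    by (intro sum_mono card_UN_le) simp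
  finally show ?thesis by simp
qed

lemma card_run_starts_le:
  assumes k_le: "64 * (k + 1) \<le> 2 ^ a"
  shows "real (card (run_starts k T))
    \<le> real (length T) * (1 + 1156 * (real (k + 1) * (real a + 2)))"
proof -
  define n where "n = length T"
  let ?J = "{j. 2 ^ j \<le> n}" and ?N = "real n * (real a + 2)"
  let ?sparse = "\<Sum>j\<in>?J. \<Sum>t\<le>n div 2 ^ j. min (real (2 ^ j)) (64 * real (k + 1))"
  let ?dense = "\<Sum>j\<in>?J. \<Sum>t\<le>n div 2 ^ j. \<Sum>R\<in>charged_runs T k (2 ^ j) t. run_weight T (2 ^ j) R"
  have "real (card (run_starts k T))
      \<le> real (n + (\<Sum>j\<in>?J. \<Sum>t\<le>n div 2 ^ j. card (block k T (2 ^ j) t)))"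
    unfolding n_def of_nat_le_iff by (rule card_run_starts_le_sum_card_block)
  also have "\<dots> = real n + (\<Sum>j\<in>?J. \<Sum>t\<le>n div 2 ^ j. real (card (block k T (2 ^ j) t)))"
    by simp
  also have "(\<Sum>j\<in>?J. \<Sum>t\<le>n div 2 ^ j. real (card (block k T (2 ^ j) t)))
      \<le> (\<Sum>j\<in>?J. \<Sum>t\<le>n div 2 ^ j. real (k + 1) * (2 * min (real (2 ^ j)) (64 * real (k + 1)) +
           16 * (\<Sum>R\<in>charged_runs T k (2 ^ j) t. run_weight T (2 ^ j) R)))"
    by (intro sum_mono card_block_le_sum_run_weight)
  also have "\<dots> = real (k + 1) * (2 * ?sparse + 16 * ?dense)"
    by (simp only: sum_distrib_left [symmetric] sum.distrib)
  also have "\<dots> \<le> real (k + 1) * (2 * (2 * ?N) + 16 * (72 * ?N))"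
  proof (intro mult_left_mono add_mono)
    have "real (64 * (k + 1)) \<le> real (2 ^ a)"
      using k_le by (simp only: of_nat_le_iff)
    then show "?sparse \<le> 2 * ?N"
      by (intro sum_min_scale_over_blocks_le) simp_all
    show "?dense \<le> 72 * ?N"
      unfolding n_def using k_le finite_power_le by (intro sum_charged_runs_le) auto
  qed simp_all
  also have "real n + real (k + 1) * (2 * (2 * ?N) + 16 * (72 * ?N))
      = real n * (1 + 1156 * (real (k + 1) * (real a + 2)))"
    by (simp add: algebra_simps)
  finally show ?thesis
    unfolding n_def by simp
qed

lemma card_run_starts_le_log:
  assumes k_pos: "1 \<le> k"
  shows "real (card (run_starts k T))
    \<le> 24000 * (real (length T) * real k * max 1 (log 2 (real k)))"
proof -
  define b where "b = floor_log k"
  define M where "M = max 1 (log 2 (real k))"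
  have "k < 2 * 2 ^ b"
    by (simp add: b_def floor_log_exp2_gt)
  then have scale: "64 * (k + 1) \<le> 2 ^ (b + 7)"
    by (simp add: power_add)
  have "2 ^ b \<le> k"
    using k_pos by (simp add: b_def floor_log_exp2_le)
  then have "real b \<le> M"
    using le_log2_of_power [of b k] by (simp add: M_def)
  moreover have M_ge_1: "1 \<le> M" by (simp add: M_def)
  ultimately have "real (k + 1) * (real (b + 7) + 2) \<le> (2 * real k) * (10 * M)"
    using k_pos by (intro mult_mono) auto
  moreover have "1 \<le> real k * M"
    using mult_mono [of 1 "real k" 1 M] k_pos M_ge_1 by simp
  ultimately have "1 + 1156 * (real (k + 1) * (real (b + 7) + 2)) \<le> 24000 * (real k * M)"
    by linarith
  then have "real (length T) * (1 + 1156 * (real (k + 1) * (real (b + 7) + 2)))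
      \<le> real (length T) * (24000 * (real k * M))"
    by (rule mult_left_mono) simp
  with card_run_starts_le [OF scale, of T] show ?thesis
    by (simp add: M_def mult_ac)
qed

theorem theorem1:
  "\<exists>C::real. C > 0 \<and>
     (\<forall>(k::nat) (T::'a list). k \<ge> 1 \<longrightarrow>
        real (card (k_runs k T)) \<le> C * (real (length T) * real k * max 1 (log 2 (real k))))"
proof (intro exI [of _ 24001] conjI allI impI)
  fix k :: nat and T :: "'a list" assume k_pos: "1 \<le> k"
  let ?B = "real (length T) * real k * max 1 (log 2 (real k))"
  have "1 \<le> real k * max 1 (log 2 (real k))"
    using k_pos mult_mono [of 1 "real k" 1 "max 1 (log 2 (real k))"] by simp
  then have "real (length T) \<le> ?B"
    using mult_left_mono [of 1 _ "real (length T)"] by (simp add: mult.assoc)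
  moreover have "real (card (run_starts k T)) \<le> 24000 * ?B"
    using k_pos by (rule card_run_starts_le_log)
  moreover have "real (card (k_runs k T)) \<le> real (length T) + real (card (run_starts k T))"
    using card_k_runs_le [of k T] by (simp flip: of_nat_add)
  ultimately show "real (card (k_runs k T)) \<le> 24001 * ?B" by linarith
qed simp

end
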